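(* If a Hilbert domain $(\mathcal{C}, d_{\mathcal{C}})$ in $\mathbf{R}^m$ is $(A,B)$-quasi-isometric to a normed vector space $(V, \|\cdot\|)$ for some real constants $A \geq 1$ and $B \geq 0$, then $\mathcal{C}$ is the interior of a convex polytope.
   Context: Hilbert domain: a Hilbert domain in $\mathbf{R}^m$ is a metric space $(\mathcal{C}, d_{\mathcal{C}})$, where $\mathcal{C}$ is an open bounded convex set in $\mathbf{R}^m$ and $d_{\mathcal{C}}$ is the distance function on $\mathcal{C}$, called the Hilbert metric, defined as follows. Set $d_{\mathcal{C}}(p,p) = 0$. Given two distinct points $p, q \in \mathcal{C}$, let $a$ and $b$ be the intersection points of the straight line defined by $p$ and $q$ with the boundary $\partial\mathcal{C}$, so that $p = (1-s)a + s b$ and $q = (1-t)a + t b$ with $0 < s < t < 1$. Then $$d_{\mathcal{C}}(p,q) = \frac{1}{2}\ln\left( \frac{1-s}{s} \times \frac{t}{1-t} \right).$$ Quasi-isometric: given real numbers $A \geq 1$ and $B \geq 0$, a metric space $(S,d)$ is said to be $(A,B)$-quasi-isometric to a normed vector space $(V, \|\cdot\|)$ if and only if there exists a map $f : S \to V$ such that $$\frac{1}{A} d(p,q) - B \leq \|f(p) - f(q)\| \leq A\, d(p,q) + B \quad \text{for all } p, q \in S.$$ Convex polytope: a convex polytope in $\mathbf{R}^m$ is the convex hull of a finite set of points whose affine span is the whole space $\mathbf{R}^m$.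
   Formalization: The normed vector space V is assumed finite-dimensional and the Hilbert domain nonempty; without the former the claim fails, since every Hilbert domain (e.g. the open disc) embeds isometrically in a space of bounded functions. *)

theory Defs
  imports "HOL-Analysis.Analysis"
begin

(* Nonemptiness is part of the notion: the empty set, although open, bounded and convex, is the
   interior of no convex polytope with full affine span. *)
definition hilbert_domain :: "(real ^ 'n) set \<Rightarrow> bool" where
  "hilbert_domain C \<longleftrightarrow> open C \<and> bounded C \<and> convex C \<and> C \<noteq> {}"

(* The boundary points a, b are labelled so that a, p, q, b occur in this order on the line.
   The description is meaningful only for distinct p, q in a Hilbert domain C; there it
   determines a unique number, see hilbert_dist_wf. *)
definition hilbert_dist :: "(real ^ 'n) set \<Rightarrow> real ^ 'n \<Rightarrow> real ^ 'n \<Rightarrow> real" where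
  "hilbert_dist C p q =
    (if p = q then 0
     else THE d. \<exists>a b s t. a \<in> frontier C \<and> b \<in> frontier C \<and> 0 < s \<and> s < t \<and> t < 1 \<and>
            p = (1 - s) *\<^sub>R a + s *\<^sub>R b \<and> q = (1 - t) *\<^sub>R a + t *\<^sub>R b \<and>
            d = 1/2 * ln ((1 - s) / s * (t / (1 - t))))"

(* The map f is required to be neither continuous nor coarsely surjective. Every metric space
   is therefore (1,0)-quasi-isometric to some infinite-dimensional space (Kuratowski embedding),
   so results about Hilbert domains must take the target space to be finite-dimensional. *)
definition quasi_isometric ::
    "real \<Rightarrow> real \<Rightarrow> 'a set \<Rightarrow> ('a \<Rightarrow> 'a \<Rightarrow> real) \<Rightarrow> 'v::real_normed_vector itself \<Rightarrow> bool" where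
  "quasi_isometric A B S d (_ :: 'v itself) \<longleftrightarrow>
    (\<exists>f :: 'a \<Rightarrow> 'v. \<forall>p\<in>S. \<forall>q\<in>S.
       1 / A * d p q - B \<le> norm (f p - f q) \<and> norm (f p - f q) \<le> A * d p q + B)"

definition convex_polytope :: "(real ^ 'n) set \<Rightarrow> bool" where
  "convex_polytope P \<longleftrightarrow> (\<exists>F. finite F \<and> affine hull F = UNIV \<and> P = convex hull F)"

lemma frontier_ray_unique:
  fixes C :: "(real ^ 'n) set"
  assumes "open C" "convex C" "p \<in> C" "l \<noteq> 0" "0 < x" "0 < y"
    and "p + x *\<^sub>R l \<in> frontier C" "p + y *\<^sub>R l \<in> frontier C"
  shows "x = y"
proof -
  have no: "\<not> u < v" if "0 < u" "p + u *\<^sub>R l \<in> frontier C" "p + v *\<^sub>R l \<in> frontier C" for u v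
  proof
    assume "u < v"
    have "open_segment p (p + v *\<^sub>R l) \<subseteq> interior C"
      using assms that by (intro in_interior_closure_convex_segment)
        (auto simp: interior_open frontier_def)
    moreover have "p + u *\<^sub>R l \<in> open_segment p (p + v *\<^sub>R l)"
      using \<open>u < v\<close> \<open>0 < u\<close> \<open>l \<noteq> 0\<close>
      by (auto simp: in_segment algebra_simps intro!: exI[of _ "u / v"])
    ultimately show False using that by (auto simp: frontier_def)
  qed
  show ?thesis using no[of x y] no[of y x] assms by linarith
qed

lemma hilbert_dist_wf:
  fixes C :: "(real ^ 'n) set"
  assumes "hilbert_domain C" "p \<in> C" "q \<in> C" "p \<noteq> q"
  shows "\<exists>!d. \<exists>a b s t. a \<in> frontier C \<and> b \<in> frontier C \<and> 0 < s \<and> s < t \<and> t < 1 \<and>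
            p = (1 - s) *\<^sub>R a + s *\<^sub>R b \<and> q = (1 - t) *\<^sub>R a + t *\<^sub>R b \<and>
            d = 1/2 * ln ((1 - s) / s * (t / (1 - t)))"
proof (rule ex_ex1I)
  have C: "open C" "bounded C" "convex C" using assms by (auto simp: hilbert_domain_def)
  define l where "l = q - p"
  have l: "l \<noteq> 0" "- l \<noteq> 0" using assms by (auto simp: l_def)
  have int: "p \<in> interior C" "q \<in> interior C" using C assms by (auto simp: interior_open)
  obtain x where x: "0 < x" "p + x *\<^sub>R (- l) \<in> frontier C"
    using ray_to_frontier[OF C(2) int(1) l(2)] by metis
  obtain z where z: "0 < z" "q + z *\<^sub>R l \<in> frontier C"
    using ray_to_frontier[OF C(2) int(2) l(1)] by metis
  define w where "w = 1 + x + z"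
  have w: "w > 0" using x z by (simp add: w_def)
  define s where "s = x / w"
  define t where "t = (1 + x) / w"
  have st: "0 < s" "s < t" "t < 1"
    using x z w by (auto simp: s_def t_def divide_simps w_def)
  have ba: "(q + z *\<^sub>R l) - (p + x *\<^sub>R (- l)) = w *\<^sub>R l"
    by (simp add: l_def w_def algebra_simps)
  have conv: "(1 - u) *\<^sub>R a + u *\<^sub>R b = a + u *\<^sub>R (b - a)" for u and a b :: "real ^ 'n"
    by (simp add: algebra_simps)
  have "p = (1 - s) *\<^sub>R (p + x *\<^sub>R (- l)) + s *\<^sub>R (q + z *\<^sub>R l)"
    unfolding conv ba using w by (simp add: s_def)
  moreover have "q = (1 - t) *\<^sub>R (p + x *\<^sub>R (- l)) + t *\<^sub>R (q + z *\<^sub>R l)"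
    unfolding conv ba
  proof -
    have "t *\<^sub>R w *\<^sub>R l = (1 + x) *\<^sub>R l" using w by (simp add: t_def)
    then show "q = p + x *\<^sub>R (- l) + t *\<^sub>R w *\<^sub>R l" by (simp add: l_def algebra_simps)
  qed
  ultimately show "\<exists>d a b s t. a \<in> frontier C \<and> b \<in> frontier C \<and> 0 < s \<and> s < t \<and> t < 1 \<and>
            p = (1 - s) *\<^sub>R a + s *\<^sub>R b \<and> q = (1 - t) *\<^sub>R a + t *\<^sub>R b \<and>
            d = 1/2 * ln ((1 - s) / s * (t / (1 - t)))"
    using x z st by blast
next
  have C: "open C" "convex C" using assms by (auto simp: hilbert_domain_def)
  define l where "l = q - p"
  have l: "l \<noteq> 0" "- l \<noteq> 0" using assms by (auto simp: l_def)
  have par: "p + (s / (t - s)) *\<^sub>R (- l) = a" "p + ((1 - s) / (t - s)) *\<^sub>R l = b"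
    if "s < t" "p = (1 - s) *\<^sub>R a + s *\<^sub>R b" "q = (1 - t) *\<^sub>R a + t *\<^sub>R b" for a b s t
  proof -
    have "l = (t - s) *\<^sub>R (b - a)" unfolding l_def that(2,3) by (simp add: algebra_simps)
    then have "(1 / (t - s)) *\<^sub>R l = b - a" using that(1) by simp
    then have k: "(k / (t - s)) *\<^sub>R l = k *\<^sub>R (b - a)" for k
      by (metis scaleR_scaleR mult.right_neutral times_divide_eq_right)
    show "p + (s / (t - s)) *\<^sub>R (- l) = a" "p + ((1 - s) / (t - s)) *\<^sub>R l = b"
      unfolding scaleR_minus_right k that(2) by (simp_all add: algebra_simps)
  qed
  fix d d'
  assume "\<exists>a b s t. a \<in> frontier C \<and> b \<in> frontier C \<and> 0 < s \<and> s < t \<and> t < 1 \<and>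
            p = (1 - s) *\<^sub>R a + s *\<^sub>R b \<and> q = (1 - t) *\<^sub>R a + t *\<^sub>R b \<and>
            d = 1/2 * ln ((1 - s) / s * (t / (1 - t)))"
  then obtain a b s t where 1: "a \<in> frontier C" "b \<in> frontier C" "0 < s" "s < t" "t < 1"
      "p = (1 - s) *\<^sub>R a + s *\<^sub>R b" "q = (1 - t) *\<^sub>R a + t *\<^sub>R b"
      "d = 1/2 * ln ((1 - s) / s * (t / (1 - t)))"
    by blast
  assume "\<exists>a b s t. a \<in> frontier C \<and> b \<in> frontier C \<and> 0 < s \<and> s < t \<and> t < 1 \<and>
            p = (1 - s) *\<^sub>R a + s *\<^sub>R b \<and> q = (1 - t) *\<^sub>R a + t *\<^sub>R b \<and>
            d' = 1/2 * ln ((1 - s) / s * (t / (1 - t)))"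
  then obtain a' b' s' t' where 2: "a' \<in> frontier C" "b' \<in> frontier C" "0 < s'" "s' < t'" "t' < 1"
      "p = (1 - s') *\<^sub>R a' + s' *\<^sub>R b'" "q = (1 - t') *\<^sub>R a' + t' *\<^sub>R b'"
      "d' = 1/2 * ln ((1 - s') / s' * (t' / (1 - t')))"
    by blast
  have e1: "s / (t - s) = s' / (t' - s')"
    by (rule frontier_ray_unique[OF C assms(2) l(2)])
       (use 1(1-5) 2(1-5) par[OF 1(4,6,7)] par[OF 2(4,6,7)] in auto)
  have e2: "(1 - s) / (t - s) = (1 - s') / (t' - s')"
    by (rule frontier_ray_unique[OF C assms(2) l(1)])
       (use 1(1-5) 2(1-5) par[OF 1(4,6,7)] par[OF 2(4,6,7)] in auto)
  have "s / (t - s) + (1 - s) / (t - s) = s' / (t' - s') + (1 - s') / (t' - s')"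
    using e1 e2 by simp
  then have "1 / (t - s) = 1 / (t' - s')"
    by (simp add: add_divide_distrib[symmetric])
  then have ts: "t - s = t' - s'" by simp
  then have "s = s'" using e1 1(4) by simp
  with ts have "t = t'" by simp
  with \<open>s = s'\<close> show "d = d'" using 1(8) 2(8) by simp
qed

end

theory Submission
  imports Defs
begin

text \<open>
  The proof looks at the domain from the side of its facets. Call \<open>u\<close> a touching normal of \<open>C\<close> if
  some ball inside \<open>C\<close> meets the boundary at a point \<open>y\<close> with outer unit normal \<open>u\<close>, so that
  \<open>{x. u \<bullet> x \<le> u \<bullet> y}\<close> is a half-space supporting \<open>C\<close>. Since the ball already forces the tangent
  hyperplane, \<open>y\<close> is a smooth boundary point. Two facts about these half-spaces carry the argument.

  First, they cut out the closure of \<open>C\<close> (\<open>ex_touches_separating\<close>): a largest inscribed ball whose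
  centre lies close to the point where a segment from inside \<open>C\<close> to an outer point \<open>z\<close> leaves \<open>C\<close>
  touches the boundary at a point whose tangent hyperplane separates \<open>z\<close> from \<open>C\<close>. Hence \<open>C\<close> is the
  interior of a polytope as soon as there are only finitely many touching normals.

  Second, touching points \<open>y\<close>, \<open>y'\<close> with distinct normals lie strictly inside each other's
  half-space (\<open>touches_normal_unique\<close>), and therefore the rays from an inner point \<open>x\<close> to \<open>y\<close> and
  to \<open>y'\<close> diverge as fast as possible: the points at parameter \<open>L\<close> have Hilbert distance at most
  \<open>L / 2 + c\<close> from \<open>x\<close> and at least \<open>L - c\<close> from each other. A quasi-isometry with
  multiplicative constant \<open>A\<close>, followed by a rescaling by \<open>1 / L\<close> for large \<open>L\<close>, turns any finite
  family of such rays into equally many points in a ball of radius \<open>A\<close> with mutual distances at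
  least \<open>1 / (2 * A)\<close>. In a finite-dimensional space the size of such a family is bounded, so the
  touching normals are finite in number.
\<close>

section \<open>Compactness in finite-dimensional normed spaces\<close>

text \<open>
  With \<open>d > 0\<close> the distance from \<open>v\<close> to the span of \<open>E\<close>, the coefficient \<open>k\<close> of \<open>v\<close> in \<open>k *\<^sub>R v + s\<close>
  is at most the norm divided by \<open>d\<close>. A bounded vector thus has bounded components, and the ball is
  a closed part of the continuous image of a product of compact sets.
\<close>
lemma compact_cball_Int_span_insert:
  fixes v :: "'v::real_normed_vector"
  assumes cpt: "\<And>R. compact (cball 0 R \<inter> span E)"
  shows "compact (cball 0 R \<inter> span (insert v E))"
proof (cases "v \<in> span E")
  case True
  then show ?thesis using cpt by (simp add: span_redundant)
next
  case False
  \<comment> \<open>The distance to the span is attained: outside this ball every vector is farther from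
    \<open>- v\<close> than \<open>0\<close> is.\<close>
  let ?S = "cball 0 (2 * norm v + 1) \<inter> span E"
  have z: "0 \<in> ?S" by (simp add: span_zero)
  then have "?S \<noteq> {}" by blast
  moreover have "continuous_on ?S (\<lambda>s. norm (v + s))" by (intro continuous_intros)
  ultimately obtain m where m: "m \<in> ?S" and min: "\<And>s. s \<in> ?S \<Longrightarrow> norm (v + m) \<le> norm (v + s)"
    using continuous_attains_inf[OF cpt] by blast
  define d where "d = norm (v + m)"
  have "v + m \<noteq> 0"
    using False m by (metis Int_iff add_eq_0_iff2 span_neg)
  then have d: "d > 0" by (simp add: d_def)
  have dle: "d \<le> norm (v + s)" if "s \<in> span E" for s
  proof (cases "s \<in> ?S")
    case False
    have "d \<le> norm v" using min[OF z] by (simp add: d_def)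
    moreover have "norm s > 2 * norm v + 1" using False that by auto
    ultimately show ?thesis using norm_triangle_ineq4[of "v + s" v] by simp
  qed (use min in \<open>simp add: d_def\<close>)
  have coef: "\<bar>k\<bar> * d \<le> norm (k *\<^sub>R v + s)" if "s \<in> span E" for k s
  proof (cases "k = 0")
    case False
    have "k *\<^sub>R v + s = k *\<^sub>R (v + (1/k) *\<^sub>R s)" using False by (simp add: algebra_simps)
    then have "norm (k *\<^sub>R v + s) = \<bar>k\<bar> * norm (v + (1/k) *\<^sub>R s)" by simp
    moreover have "d \<le> norm (v + (1/k) *\<^sub>R s)" using dle span_scale[OF that] by blast
    ultimately show ?thesis by (simp add: mult_left_mono)
  qed simp
  let ?g = "\<lambda>(k, s). k *\<^sub>R v + s"
  let ?D = "cball (0::real) (R / d) \<times> (cball 0 (R + (R / d) * norm v) \<inter> span E)"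
  have "compact (?g ` ?D)"
    by (intro compact_continuous_image compact_Times cpt compact_cball)
       (auto simp: case_prod_unfold intro!: continuous_intros)
  then have "compact (cball 0 R \<inter> ?g ` ?D)"
    by (intro closed_Int_compact closed_cball)
  moreover have "cball 0 R \<inter> span (insert v E) = cball 0 R \<inter> ?g ` ?D"
  proof (intro equalityI subsetI)
    fix x assume x: "x \<in> cball 0 R \<inter> span (insert v E)"
    then obtain k where k: "x - k *\<^sub>R v \<in> span E" by (auto simp: span_insert)
    have "\<bar>k\<bar> * d \<le> R" using coef[OF k, of k] x by auto
    then have kd: "\<bar>k\<bar> \<le> R / d" using d by (simp add: field_simps)
    then have "\<bar>k\<bar> * norm v \<le> R / d * norm v" by (rule mult_right_mono) simp
    moreover have "norm (x - k *\<^sub>R v) \<le> norm x + \<bar>k\<bar> * norm v"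
      using norm_triangle_ineq4[of x "k *\<^sub>R v"] by simp
    ultimately have "norm (x - k *\<^sub>R v) \<le> R + R / d * norm v" using x by auto
    with kd k have "(k, x - k *\<^sub>R v) \<in> ?D" by simp
    then have "?g (k, x - k *\<^sub>R v) \<in> ?g ` ?D" by (rule imageI)
    then show "x \<in> cball 0 R \<inter> ?g ` ?D" using x by simp
  next
    fix x assume x: "x \<in> cball 0 R \<inter> ?g ` ?D"
    then obtain k s where "x = k *\<^sub>R v + s" "s \<in> span E" by auto
    then have "x \<in> span (insert v E)"
      by (metis insertI1 span_add span_base span_mono span_scale subsetD subset_insertI)
    then show "x \<in> cball 0 R \<inter> span (insert v E)" using x by simp
  qed
  ultimately show ?thesis by simp
qed

lemma compact_cball_Int_span:
  fixes E :: "'v::real_normed_vector set"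
  assumes "finite E"
  shows "compact (cball 0 R \<inter> span E)"
  using assms
proof (induction E arbitrary: R)
  case empty
  show ?case by (cases "R \<ge> 0") auto
next
  case (insert v E)
  then show ?case by (intro compact_cball_Int_span_insert)
qed

text \<open>
  Cover \<open>S\<close> by finitely many balls of radius \<open>\<delta> / 2\<close>; a separated family meets each of them at most
  once.
\<close>
lemma compact_separated_card_bound:
  fixes S :: "'a::metric_space set"
  assumes "compact S" "\<delta> > 0"
  shows "\<exists>M. \<forall>(g :: 'i \<Rightarrow> 'a) I. finite I \<longrightarrow> g ` I \<subseteq> S \<longrightarrow>
    (\<forall>i\<in>I. \<forall>j\<in>I. i \<noteq> j \<longrightarrow> \<delta> \<le> dist (g i) (g j)) \<longrightarrow> card I \<le> M"
proof -
  obtain K where K: "finite K" "S \<subseteq> (\<Union>x\<in>K. ball x (\<delta> / 2))"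
    using compactE_image[OF assms(1), of S "\<lambda>x. ball x (\<delta> / 2)"] assms(2)
    by (metis UN_I centre_in_ball half_gt_zero open_ball subsetI)
  have "card I \<le> card K"
    if "finite I" "g ` I \<subseteq> S" and sep: "\<forall>i\<in>I. \<forall>j\<in>I. i \<noteq> j \<longrightarrow> \<delta> \<le> dist (g i) (g j)"
    for g :: "'i \<Rightarrow> 'a" and I
  proof -
    have "\<forall>i\<in>I. \<exists>x\<in>K. dist x (g i) < \<delta> / 2" using K that by fastforce
    then obtain h where h: "\<And>i. i \<in> I \<Longrightarrow> h i \<in> K \<and> dist (h i) (g i) < \<delta> / 2" by metis
    have "inj_on h I"
    proof (rule inj_onI, rule ccontr)
      fix i j assume ij: "i \<in> I" "j \<in> I" "h i = h j" "i \<noteq> j"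
      then have "dist (g i) (g j) < \<delta>"
        using h[of i] h[of j] dist_triangle2[of "g i" "g j" "h i"] by (simp add: dist_commute)
      then show False using sep ij by fastforce
    qed
    then show ?thesis using h K(1) by (intro card_inj_on_le[of h]) auto
  qed
  then show ?thesis by blast
qed

section \<open>Estimates for the Hilbert metric\<close>

lemma hilbert_dist_eq:
  fixes C :: "(real ^ 'n) set"
  assumes C: "hilbert_domain C" and pq: "p \<in> C" "q \<in> C"
    and ab: "a \<in> frontier C" "b \<in> frontier C" and st: "0 < s" "s < t" "t < 1"
    and p: "p = (1 - s) *\<^sub>R a + s *\<^sub>R b" and q: "q = (1 - t) *\<^sub>R a + t *\<^sub>R b"
  shows "hilbert_dist C p q = 1/2 * ln ((1 - s) / s * (t / (1 - t)))"
proof -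
  have "p \<noteq> q"
  proof
    assume "p = q"
    then have "(t - s) *\<^sub>R (b - a) = 0" using p q by (simp add: algebra_simps)
    then have "a = b" using st by simp
    then have "p = a" using p by (simp add: algebra_simps)
    then show False using ab pq C by (auto simp: hilbert_domain_def frontier_def interior_open)
  qed
  show ?thesis unfolding hilbert_dist_def if_not_P[OF \<open>p \<noteq> q\<close>]
    by (rule the1_equality[OF hilbert_dist_wf[OF C pq \<open>p \<noteq> q\<close>]])
      (use ab st p q in blast)
qed

lemma open_subset_halfspace_less:
  fixes u :: "'a::euclidean_space"
  assumes "open C" "C \<subseteq> {x. u \<bullet> x \<le> \<alpha>}" "u \<noteq> 0" "x \<in> C"
  shows "u \<bullet> x < \<alpha>"
proof -
  have "C \<subseteq> interior {x. u \<bullet> x \<le> \<alpha>}" using assms by (intro interior_maximal)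
  then show ?thesis using assms by (auto simp: interior_halfspace_le)
qed

text \<open>
  Each of the two factors of the cross-ratio is bounded separately. The affine function
  \<open>\<lambda>x. \<alpha> - u \<bullet> x\<close> is nonnegative at the boundary point \<open>a\<close> beyond \<open>p\<close>, hence its ratio at \<open>q\<close> and
  \<open>p\<close> is at most the ratio of the distances of \<open>q\<close> and \<open>p\<close> to \<open>a\<close>; likewise for \<open>v\<close> at the other end.
\<close>
lemma hilbert_dist_ge_halfspaces:
  fixes C :: "(real ^ 'n) set"
  assumes C: "hilbert_domain C" and pq: "p \<in> C" "q \<in> C"
    and u: "C \<subseteq> {x. u \<bullet> x \<le> \<alpha>}" "u \<noteq> 0" and v: "C \<subseteq> {x. v \<bullet> x \<le> \<beta>}" "v \<noteq> 0"
  shows "1/2 * ln ((\<alpha> - u \<bullet> q) / (\<alpha> - u \<bullet> p) * ((\<beta> - v \<bullet> p) / (\<beta> - v \<bullet> q))) \<le> hilbert_dist C p q"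
proof (cases "p = q")
  case True
  have "open C" using C by (simp add: hilbert_domain_def)
  then have "u \<bullet> q < \<alpha>" "v \<bullet> q < \<beta>" using open_subset_halfspace_less u v pq by blast+
  then show ?thesis using True by (simp add: hilbert_dist_def)
next
  case False
  have opn: "open C" using C by (simp add: hilbert_domain_def)
  obtain a b s t where ab: "a \<in> frontier C" "b \<in> frontier C" and st: "0 < s" "s < t" "t < 1"
    and p: "p = (1 - s) *\<^sub>R a + s *\<^sub>R b" and q: "q = (1 - t) *\<^sub>R a + t *\<^sub>R b"
    using hilbert_dist_wf[OF C pq False] by metis
  have d: "hilbert_dist C p q = 1/2 * ln ((1 - s) / s * (t / (1 - t)))"
    by (rule hilbert_dist_eq[OF C pq ab st p q])
  have cl: "closure C \<subseteq> {x. u \<bullet> x \<le> \<alpha>}" "closure C \<subseteq> {x. v \<bullet> x \<le> \<beta>}"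
    using u v by (simp_all add: closure_minimal closed_halfspace_le)
  have ua: "u \<bullet> a \<le> \<alpha>" and vb: "v \<bullet> b \<le> \<beta>"
    using cl ab by (auto simp: frontier_def)
  have pos: "u \<bullet> p < \<alpha>" "u \<bullet> q < \<alpha>" "v \<bullet> p < \<beta>" "v \<bullet> q < \<beta>"
    using open_subset_halfspace_less[OF opn] u v pq by blast+
  have "t * (\<alpha> - u \<bullet> p) - s * (\<alpha> - u \<bullet> q) = (t - s) * (\<alpha> - u \<bullet> a)"
    unfolding p q by (simp add: inner_simps algebra_simps)
  moreover have "(t - s) * (\<alpha> - u \<bullet> a) \<ge> 0" using st ua by simp
  ultimately have 1: "(\<alpha> - u \<bullet> q) / (\<alpha> - u \<bullet> p) \<le> t / s"
    using st pos by (simp add: field_simps)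
  have "(1 - s) * (\<beta> - v \<bullet> q) - (1 - t) * (\<beta> - v \<bullet> p) = (t - s) * (\<beta> - v \<bullet> b)"
    unfolding p q by (simp add: inner_simps algebra_simps)
  moreover have "(t - s) * (\<beta> - v \<bullet> b) \<ge> 0" using st vb by simp
  ultimately have 2: "(\<beta> - v \<bullet> p) / (\<beta> - v \<bullet> q) \<le> (1 - s) / (1 - t)"
    using st pos by (simp add: field_simps)
  have "(\<alpha> - u \<bullet> q) / (\<alpha> - u \<bullet> p) * ((\<beta> - v \<bullet> p) / (\<beta> - v \<bullet> q)) \<le> t / s * ((1 - s) / (1 - t))"
    using 1 2 st pos by (intro mult_mono) auto
  moreover have "0 < (\<alpha> - u \<bullet> q) / (\<alpha> - u \<bullet> p) * ((\<beta> - v \<bullet> p) / (\<beta> - v \<bullet> q))"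
    using pos by simp
  ultimately show ?thesis unfolding d by (simp add: mult.commute)
qed

text \<open>
  The segment from \<open>x\<close> to \<open>y\<close>, parametrised so that the Hilbert distance from \<open>x\<close> grows like \<open>L / 2\<close>
  when \<open>y\<close> is a boundary point.
\<close>
definition ray_point :: "'a::real_vector \<Rightarrow> 'a \<Rightarrow> real \<Rightarrow> 'a" where
  "ray_point x y L = y + exp (- L) *\<^sub>R (x - y)"

lemma ray_point_mem:
  fixes C :: "'a::euclidean_space set"
  assumes "open C" "convex C" "x \<in> C" "y \<in> closure C" "L > 0"
  shows "ray_point x y L \<in> C"
proof -
  have "y - exp (- L) *\<^sub>R (y - x) \<in> interior C"
    using assms by (intro mem_interior_closure_convex_shrink) (auto simp: interior_open)
  then show ?thesis using assms(1) by (simp add: ray_point_def interior_open algebra_simps)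
qed

text \<open>
  On the chord through \<open>x\<close> and \<open>y\<close>, only the factor of the cross-ratio belonging to \<open>y\<close> is unbounded,
  and it equals \<open>exp L\<close>; the other factor is at most \<open>1 / s\<close>, where \<open>s\<close> is the position of \<open>x\<close>.
\<close>
lemma hilbert_dist_ray_point_le:
  fixes C :: "(real ^ 'n) set"
  assumes C: "hilbert_domain C" and x: "x \<in> C" and y: "y \<in> frontier C"
  obtains c where "\<And>L. L > 0 \<Longrightarrow> hilbert_dist C x (ray_point x y L) \<le> L / 2 + c"
proof -
  have C': "open C" "bounded C" "convex C" using C by (auto simp: hilbert_domain_def)
  have "x \<noteq> y" using x y C' by (auto simp: frontier_def interior_open)
  then obtain e where e: "0 < e" "x + e *\<^sub>R (x - y) \<in> frontier C"
    using ray_to_frontier[OF C'(2), of x "x - y"] x C' by (auto simp: interior_open)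
  define a where "a = x + e *\<^sub>R (x - y)"
  define s where "s = e / (1 + e)"
  have s: "0 < s" "s < 1" using e by (auto simp: s_def)
  have xs: "x = (1 - s) *\<^sub>R a + s *\<^sub>R y"
  proof -
    have "(1 - s) *\<^sub>R a + s *\<^sub>R y = x + ((1 - s) * e - s) *\<^sub>R (x - y)"
      by (simp add: a_def algebra_simps)
    also have "(1 - s) * e - s = 0" using e by (simp add: s_def field_simps)
    finally show ?thesis by simp
  qed
  have "hilbert_dist C x (ray_point x y L) \<le> L / 2 + 1/2 * ln (1 / s)" if L: "L > 0" for L
  proof -
    define \<delta> where "\<delta> = exp (- L) * (1 - s)"
    define t where "t = 1 - \<delta>"
    have "\<delta> < 1 * (1 - s)"
      unfolding \<delta>_def using L s by (intro mult_strict_right_mono) auto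
    moreover have "0 < \<delta>" using s by (simp add: \<delta>_def)
    ultimately have st: "s < t" "t < 1" by (simp_all add: t_def)
    have "ray_point x y L = (1 - t) *\<^sub>R a + t *\<^sub>R y"
      unfolding ray_point_def t_def \<delta>_def by (subst xs) (simp add: algebra_simps)
    moreover have "ray_point x y L \<in> C"
      using ray_point_mem[OF C'(1,3) x _ L] y by (simp add: frontier_def)
    ultimately have "hilbert_dist C x (ray_point x y L) = 1/2 * ln ((1 - s) / s * (t / (1 - t)))"
      using hilbert_dist_eq[OF C x _ _ y s(1) st xs] e(2) by (simp add: a_def)
    also have "(1 - s) / s * (t / (1 - t)) = t * (1 / s * exp L)"
      using s by (simp add: t_def \<delta>_def exp_minus field_simps)
    also have "1/2 * ln (t * (1 / s * exp L)) \<le> 1/2 * ln (1 * (1 / s * exp L))"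
      using s st by (intro mult_left_mono ln_mono mult_right_mono mult_pos_pos) auto
    also have "\<dots> = L / 2 + 1/2 * ln (1 / s)"
      using s by (simp add: ln_mult ln_div)
    finally show ?thesis .
  qed
  then show ?thesis using that by blast
qed

section \<open>Supporting half-spaces touched by inscribed balls\<close>

text \<open>
  The tangent ball is what makes \<open>y\<close> a smooth boundary point with outer normal \<open>u\<close>. It has to be an
  open ball, because \<open>y\<close> itself lies outside an open \<open>C\<close>.
\<close>
definition touches :: "'a::euclidean_space set \<Rightarrow> 'a \<Rightarrow> 'a \<Rightarrow> bool" where
  "touches C u y \<longleftrightarrow> norm u = 1 \<and> C \<subseteq> {x. u \<bullet> x \<le> u \<bullet> y} \<and> (\<exists>r>0. ball (y - r *\<^sub>R u) r \<subseteq> C)"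

lemma touches_closure:
  assumes "touches C u y"
  shows "y \<in> closure C" and "closure C \<subseteq> {x. u \<bullet> x \<le> u \<bullet> y}"
proof -
  obtain r where r: "r > 0" "ball (y - r *\<^sub>R u) r \<subseteq> C" "norm u = 1"
    using assms by (auto simp: touches_def)
  have "y \<in> cball (y - r *\<^sub>R u) r" using r by (simp add: dist_norm)
  then show "y \<in> closure C" using closure_mono[OF r(2)] r(1) by auto
  show "closure C \<subseteq> {x. u \<bullet> x \<le> u \<bullet> y}"
    using assms by (intro closure_minimal) (auto simp: touches_def closed_halfspace_le)
qed

lemma touches_frontier:
  assumes "touches C u y" "open C"
  shows "y \<in> frontier C"
proof -
  have "u \<noteq> 0" "C \<subseteq> {x. u \<bullet> x \<le> u \<bullet> y}" using assms by (auto simp: touches_def)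
  then have "y \<notin> C" using open_subset_halfspace_less[OF assms(2), of u "u \<bullet> y" y] by auto
  then show ?thesis using touches_closure[OF assms(1)] assms(2)
    by (simp add: frontier_def interior_open)
qed

text \<open>
  Smoothness of touching points: if \<open>y'\<close> lies on the hyperplane of \<open>u\<close>, then that half-space contains
  the whole ball touching at \<open>y'\<close>, and a ball inside a half-space meets the bounding hyperplane only
  at the point in direction \<open>u\<close> from its centre.
\<close>
lemma touches_normal_unique:
  assumes uy: "touches C u y" and u'y': "touches C u' y'" and "u \<bullet> y \<le> u \<bullet> y'"
  shows "u = u'"
proof -
  obtain r where r: "r > 0" "ball (y' - r *\<^sub>R u') r \<subseteq> C"
    using u'y' by (auto simp: touches_def)
  have n: "norm u = 1" "norm u' = 1" using uy u'y' by (auto simp: touches_def)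
  \<comment> \<open>the point of the ball at \<open>y'\<close> that is farthest in direction \<open>u\<close>\<close>
  have "y' - r *\<^sub>R u' + r *\<^sub>R u \<in> cball (y' - r *\<^sub>R u') r" using r n by (simp add: dist_norm)
  then have "y' - r *\<^sub>R u' + r *\<^sub>R u \<in> closure C" using closure_mono[OF r(2)] r(1) by auto
  then have "u \<bullet> (y' - r *\<^sub>R u' + r *\<^sub>R u) \<le> u \<bullet> y'"
    using touches_closure(2)[OF uy] assms(3) by auto
  moreover have uu: "u \<bullet> u = 1" "u' \<bullet> u' = 1" using n by (simp_all add: dot_square_norm)
  ultimately have "r * 1 \<le> r * (u \<bullet> u')" by (simp add: inner_simps)
  then have "1 \<le> u \<bullet> u'" using r(1) by simp
  moreover have "(norm (u - u'))\<^sup>2 = 2 - 2 * (u \<bullet> u')"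
    using uu by (simp add: power2_norm_eq_inner inner_diff_left inner_diff_right inner_commute)
  ultimately have "(norm (u - u'))\<^sup>2 \<le> 0" by simp
  then show ?thesis by simp
qed

text \<open>
  The largest ball around \<open>c\<close> reaches the complement at some \<open>y\<close>. Any \<open>u\<close> separating \<open>C\<close> from \<open>y\<close>
  works: since \<open>u\<close> is a unit vector, the parallel hyperplane at distance \<open>r\<close> from \<open>c\<close> lies at or
  beyond \<open>y\<close>.
\<close>
lemma ex_touches_centre:
  fixes C :: "'a::euclidean_space set"
  assumes C: "open C" "convex C" and c: "c \<in> C" and w: "w \<notin> C"
  obtains u r where "0 < r" "r \<le> dist c w" "touches C u (c + r *\<^sub>R u)"
proof -
  obtain y where y: "y \<in> - C" "\<And>x. x \<in> - C \<Longrightarrow> dist c y \<le> dist c x"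
    using distance_attains_inf[of "- C" c] C(1) w by (metis ComplI closed_Compl empty_iff)
  define r where "r = dist c y"
  have r: "r > 0" using y(1) c by (auto simp: r_def)
  have sub: "ball c r \<subseteq> C" using y(2) by (fastforce simp: r_def)
  obtain v \<beta> where v: "v \<noteq> 0" "\<And>x. x \<in> C \<Longrightarrow> v \<bullet> x \<le> \<beta>" "\<beta> \<le> v \<bullet> y"
    using separating_hyperplane_sets[of C "{y}"] C(2) c y(1) by auto
  define u where "u = v /\<^sub>R norm v"
  have n: "norm u = 1" using v(1) by (simp add: u_def)
  have "u \<bullet> x \<le> u \<bullet> (c + r *\<^sub>R u)" if "x \<in> C" for x
  proof -
    have "v \<bullet> x \<le> v \<bullet> y" using v(2)[OF that] v(3) by simp
    then have "u \<bullet> x \<le> u \<bullet> y" by (simp add: u_def divide_right_mono mult_left_mono)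
    also have "u \<bullet> y = u \<bullet> c + u \<bullet> (y - c)" by (simp add: inner_simps)
    also have "u \<bullet> (y - c) \<le> r"
      using norm_cauchy_schwarz[of u "y - c"] n by (simp add: r_def dist_norm norm_minus_commute)
    finally show ?thesis using n by (simp add: inner_simps dot_square_norm)
  qed
  then have "touches C u (c + r *\<^sub>R u)" using n r sub
    by (auto simp: touches_def intro!: exI[of _ r])
  moreover have "r \<le> dist c w" using y(2) w by (simp add: r_def)
  ultimately show ?thesis using that r by blast
qed

text \<open>
  Let the segment from \<open>x \<in> C\<close> to \<open>z\<close> leave \<open>C\<close> at \<open>w\<close>, and take the largest ball inside \<open>C\<close> around a
  point \<open>c\<close> of the segment just before \<open>w\<close>. Its radius \<open>r\<close> is tiny, while \<open>C\<close> contains a ball of fixed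
  radius \<open>\<rho>\<close> around \<open>x\<close>; so going from \<open>x\<close> to \<open>c\<close> the functional \<open>u\<close> gains at least \<open>\<rho> - r\<close>.
  By linearity it gains a definite amount more than \<open>r\<close> on the way from \<open>c\<close> to \<open>z\<close>.
\<close>
lemma ex_touches_separating:
  fixes C :: "'a::euclidean_space set"
  assumes C: "open C" "convex C" "bounded C" "C \<noteq> {}" and z: "z \<notin> closure C"
  obtains u y where "touches C u y" "u \<bullet> y < u \<bullet> z"
proof -
  obtain x where x: "x \<in> C" using C by auto
  obtain \<rho> where \<rho>: "\<rho> > 0" "cball x \<rho> \<subseteq> C" using C(1) x open_contains_cball by blast
  define l where "l = z - x"
  have "l \<noteq> 0" using x z closure_subset by (auto simp: l_def)
  then obtain k where k: "0 < k" "x + k *\<^sub>R l \<in> frontier C"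
      "\<And>e. \<lbrakk>0 \<le> e; e < k\<rbrakk> \<Longrightarrow> x + e *\<^sub>R l \<in> interior C"
    using ray_to_frontier[OF C(3), of x l] x C(1) by (auto simp: interior_open)
  have k1: "k < 1"
  proof (rule ccontr)
    assume "\<not> k < 1"
    then have "x + 1 *\<^sub>R l \<in> closure C"
      using k(2) k(3)[of 1] C(1) closure_subset
      by (cases "k = 1") (auto simp: frontier_def interior_open)
    then show False using z by (simp add: l_def)
  qed
  define w where "w = x + k *\<^sub>R l"
  have w: "w \<notin> C" using k(2) C(1) by (simp add: w_def frontier_def interior_open)
  \<comment> \<open>The second bound makes \<open>r\<close> at most \<open>(1 - k) * \<rho> / 2\<close>, a lower bound for the gain from \<open>c\<close> to \<open>z\<close>.\<close>
  define \<eta> where "\<eta> = min (k / 2) ((1 - k) * \<rho> / 2 / norm l)"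
  have "0 < (1 - k) * \<rho> / 2 / norm l" using k1 \<rho>(1) \<open>l \<noteq> 0\<close> by simp
  moreover have "\<eta> \<le> (1 - k) * \<rho> / 2 / norm l" by (simp add: \<eta>_def)
  then have "\<eta> * norm l \<le> (1 - k) * \<rho> / 2" using \<open>l \<noteq> 0\<close> by (simp add: pos_le_divide_eq)
  ultimately have \<eta>: "0 < \<eta>" "\<eta> < k" "\<eta> * norm l \<le> (1 - k) * \<rho> / 2"
    using k(1) unfolding \<eta>_def by auto
  define e where "e = k - \<eta>"
  define c where "c = x + e *\<^sub>R l"
  have e: "0 < e" "e < k" using \<eta> by (auto simp: e_def)
  have c: "c \<in> C" using k(3)[of e] e C(1) by (simp add: c_def interior_open)
  have "c - w = (- \<eta>) *\<^sub>R l" by (simp add: c_def w_def e_def algebra_simps)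
  then have cw: "dist c w = \<eta> * norm l" using \<eta>(1) by (simp add: dist_norm)
  obtain u r where r: "0 < r" "r \<le> dist c w" and t: "touches C u (c + r *\<^sub>R u)"
    using ex_touches_centre[OF C(1,2) c w] .
  have n: "norm u = 1" and uu: "u \<bullet> u = 1" using t by (auto simp: touches_def dot_square_norm)
  have rle: "r \<le> (1 - k) * \<rho> / 2" using r cw \<eta> by simp
  have "x + \<rho> *\<^sub>R u \<in> C" using \<rho> n by (intro subsetD[OF \<rho>(2)]) (simp add: dist_norm)
  then have "u \<bullet> (x + \<rho> *\<^sub>R u) \<le> u \<bullet> (c + r *\<^sub>R u)" using t by (auto simp: touches_def)
  then have ul: "\<rho> - r \<le> e * (u \<bullet> l)" using uu by (simp add: c_def inner_simps)
  have "(1 - k) * \<rho> < 1 * \<rho>" using k \<rho> by (intro mult_strict_right_mono) auto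
  then have "\<rho> - r > \<rho> / 2" using rle by simp
  then have "e * (u \<bullet> l) > \<rho> / 2" using ul by simp
  moreover from this have "u \<bullet> l > 0" using e(1) \<rho>(1)
    by (smt (verit) half_gt_zero zero_less_mult_pos)
  moreover from this have "e * (u \<bullet> l) \<le> 1 * (u \<bullet> l)" using e k1 by (intro mult_right_mono) auto
  ultimately have "\<rho> / 2 < u \<bullet> l" by (metis less_le_trans mult_1)
  then have "(1 - k) * (\<rho> / 2) < (1 - e) * (u \<bullet> l)"
    using e k1 \<rho> by (intro mult_less_le_imp_less mult_strict_mono) auto
  moreover have "u \<bullet> z - u \<bullet> (c + r *\<^sub>R u) = (1 - e) * (u \<bullet> l) - r"
    using uu by (simp add: c_def l_def inner_simps algebra_simps)
  ultimately have "u \<bullet> (c + r *\<^sub>R u) < u \<bullet> z" using rle by simp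
  with t show ?thesis using that by blast
qed

lemma finite_touches_imp_polytope:
  fixes C :: "'a::euclidean_space set"
  assumes C: "open C" "convex C" "bounded C" "C \<noteq> {}"
    and fin: "finite {u. \<exists>y. touches C u y}"
  shows "polytope (closure C)"
proof -
  let ?U = "{u. \<exists>y. touches C u y}"
  obtain y where y: "\<And>u. u \<in> ?U \<Longrightarrow> touches C u (y u)"
    using bchoice[of ?U "touches C"] by blast
  have "closure C = (\<Inter>u\<in>?U. {x. u \<bullet> x \<le> u \<bullet> y u})"
  proof (intro equalityI subsetI)
    fix x assume "x \<in> closure C"
    then show "x \<in> (\<Inter>u\<in>?U. {x. u \<bullet> x \<le> u \<bullet> y u})" using touches_closure(2)[OF y] by blast
  next
    fix x assume x: "x \<in> (\<Inter>u\<in>?U. {x. u \<bullet> x \<le> u \<bullet> y u})"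
    show "x \<in> closure C"
    proof (rule ccontr)
      assume "x \<notin> closure C"
      then obtain u y' where u: "touches C u y'" "u \<bullet> y' < u \<bullet> x"
        using ex_touches_separating[OF C] by metis
      then have "u \<in> ?U" by blast
      then have "u \<bullet> y u \<le> u \<bullet> y'" and "u \<bullet> x \<le> u \<bullet> y u"
        using touches_closure(1)[OF y[OF \<open>u \<in> ?U\<close>]] touches_closure(2)[OF u(1)] x by auto
      then show False using u by simp
    qed
  qed
  moreover have "polyhedron (\<Inter>u\<in>?U. {x. u \<bullet> x \<le> u \<bullet> y u})"
    using fin by (intro polyhedron_Inter) (auto simp: polyhedron_halfspace_le)
  ultimately have "polyhedron (closure C)" by simp
  then show ?thesis
    using C(3) by (simp add: polytope_eq_bounded_polyhedron bounded_closure)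
qed

section \<open>Quasi-isometries into finite-dimensional spaces\<close>

text \<open>
  Apply the half-space bound with the supporting half-spaces at \<open>y\<close> and \<open>y'\<close>. The distance of each
  point to its own hyperplane is \<open>exp (- L)\<close> times that of \<open>x\<close>, whereas its distance to the other
  hyperplane stays bounded below, because neither touching point lies on the hyperplane of the other.
\<close>
lemma hilbert_dist_ray_points_ge:
  fixes C :: "(real ^ 'n) set"
  assumes C: "hilbert_domain C" and x: "x \<in> C"
    and uy: "touches C u y" and u'y': "touches C u' y'" and ne: "u \<noteq> u'"
  obtains c where "\<And>L. L > 0 \<Longrightarrow> L - c \<le> hilbert_dist C (ray_point x y L) (ray_point x y' L)"
proof -
  have C': "open C" "convex C" using C by (auto simp: hilbert_domain_def)
  have sub: "C \<subseteq> {x. u \<bullet> x \<le> u \<bullet> y}" "C \<subseteq> {x. u' \<bullet> x \<le> u' \<bullet> y'}" and u0: "u \<noteq> 0" "u' \<noteq> 0"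
    using uy u'y' by (auto simp: touches_def)
  define h where "h = u \<bullet> y - u \<bullet> x"
  define h' where "h' = u' \<bullet> y' - u' \<bullet> x"
  define m where "m = min h (u \<bullet> y - u \<bullet> y')"
  define m' where "m' = min h' (u' \<bullet> y' - u' \<bullet> y)"
  have h: "h > 0" "h' > 0"
    using open_subset_halfspace_less[OF C'(1) sub(1) u0(1) x]
      open_subset_halfspace_less[OF C'(1) sub(2) u0(2) x] by (auto simp: h_def h'_def)
  have "\<not> u \<bullet> y \<le> u \<bullet> y'" "\<not> u' \<bullet> y' \<le> u' \<bullet> y"
    using touches_normal_unique[OF uy u'y'] touches_normal_unique[OF u'y' uy] ne by blast+
  then have m: "m > 0" "m' > 0" using h by (simp_all add: m_def m'_def)
  have conv: "min a b \<le> \<epsilon> * a + (1 - \<epsilon>) * b" if "0 < \<epsilon>" "\<epsilon> < 1" for a b \<epsilon> :: real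
    using convex_bound_le[of "- a" "- min a b" "- b" \<epsilon> "1 - \<epsilon>"] that by simp
  have "L - (- (1/2 * ln (m / h * (m' / h')))) \<le> hilbert_dist C (ray_point x y L) (ray_point x y' L)"
    if L: "L > 0" for L
  proof -
    define \<epsilon> where "\<epsilon> = exp (- L)"
    have \<epsilon>: "0 < \<epsilon>" "\<epsilon> < 1" using L by (auto simp: \<epsilon>_def)
    let ?p = "ray_point x y L" and ?q = "ray_point x y' L"
    have mem: "?p \<in> C" "?q \<in> C"
      using ray_point_mem[OF C' x _ L] touches_closure(1) uy u'y' by blast+
    have 1: "u \<bullet> y - u \<bullet> ?p = \<epsilon> * h" "u' \<bullet> y' - u' \<bullet> ?q = \<epsilon> * h'"
      by (auto simp: ray_point_def \<epsilon>_def h_def h'_def inner_simps algebra_simps)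
    have "u \<bullet> y - u \<bullet> ?q = \<epsilon> * h + (1 - \<epsilon>) * (u \<bullet> y - u \<bullet> y')"
      "u' \<bullet> y' - u' \<bullet> ?p = \<epsilon> * h' + (1 - \<epsilon>) * (u' \<bullet> y' - u' \<bullet> y)"
      by (auto simp: ray_point_def \<epsilon>_def h_def h'_def inner_simps algebra_simps)
    then have 2: "m \<le> u \<bullet> y - u \<bullet> ?q" "m' \<le> u' \<bullet> y' - u' \<bullet> ?p"
      using conv[OF \<epsilon>] by (simp_all add: m_def m'_def)
    have "m / (\<epsilon> * h) * (m' / (\<epsilon> * h')) = m / h * (m' / h') * (exp L * exp L)"
      by (simp add: \<epsilon>_def exp_minus field_simps)
    moreover have "0 < m / h * (m' / h')" using m h by simp
    ultimately have "L + 1/2 * ln (m / h * (m' / h')) = 1/2 * ln (m / (\<epsilon> * h) * (m' / (\<epsilon> * h')))"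
      using ln_mult[of "m / h * (m' / h')" "exp L * exp L"] m h by (simp add: ln_mult)
    also have "\<dots> \<le> 1/2 * ln ((u \<bullet> y - u \<bullet> ?q) / (\<epsilon> * h) * ((u' \<bullet> y' - u' \<bullet> ?p) / (\<epsilon> * h')))"
      using m h \<epsilon> 2 by (intro mult_left_mono ln_mono mult_mono divide_right_mono) auto
    also have "\<dots> \<le> hilbert_dist C ?p ?q"
      using hilbert_dist_ge_halfspaces[OF C mem sub(1) u0(1) sub(2) u0(2)] by (simp add: 1)
    finally show ?thesis by simp
  qed
  then show ?thesis using that by blast
qed

text \<open>
  Both the radius \<open>A\<close> and the separation \<open>1 / (2 * A)\<close> of the rescaled image points are independent of
  how many rays are considered: the constants \<open>B\<close> and those depending on the chosen touching points
  only determine how large \<open>L\<close> has to be.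
\<close>
lemma quasi_isometric_finite_touches:
  fixes C :: "(real ^ 'n) set" and E :: "'v::real_normed_vector set"
  assumes C: "hilbert_domain C" and E: "finite E" "span E = UNIV" and A: "A \<ge> 1"
    and qi: "quasi_isometric A B C (hilbert_dist C) TYPE('v)"
  shows "finite {u. \<exists>y. touches C u y}"
proof (rule ccontr)
  let ?U = "{u. \<exists>y. touches C u y}"
  assume inf: "infinite ?U"
  obtain y where y: "\<And>u. u \<in> ?U \<Longrightarrow> touches C u (y u)"
    using bchoice[of ?U "touches C"] by blast
  have C': "open C" "convex C" and "C \<noteq> {}" using C by (auto simp: hilbert_domain_def)
  then obtain x where x: "x \<in> C" by auto
  obtain f :: "real ^ 'n \<Rightarrow> 'v" where f: "\<And>p q. \<lbrakk>p \<in> C; q \<in> C\<rbrakk> \<Longrightarrow>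
       1 / A * hilbert_dist C p q - B \<le> norm (f p - f q) \<and>
       norm (f p - f q) \<le> A * hilbert_dist C p q + B"
    using qi unfolding quasi_isometric_def by blast
  have "compact (cball (0::'v) A)" using compact_cball_Int_span[OF E(1), of A] E(2) by simp
  moreover have "1 / (2 * A) > 0" using A by simp
  ultimately obtain M where M: "\<forall>(g :: real ^ 'n \<Rightarrow> 'v) I. finite I \<longrightarrow> g ` I \<subseteq> cball 0 A \<longrightarrow>
    (\<forall>i\<in>I. \<forall>j\<in>I. i \<noteq> j \<longrightarrow> 1 / (2 * A) \<le> dist (g i) (g j)) \<longrightarrow> card I \<le> M"
    using compact_separated_card_bound by blast
  obtain I where I: "finite I" "card I = Suc M" "I \<subseteq> ?U"
    using infinite_arbitrarily_large[OF inf] by blast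
  have tI: "touches C u (y u)" if "u \<in> I" for u using y I(3) that by blast
  define P where "P = (\<lambda>u. ray_point x (y u))"
  have P: "P u L \<in> C" if "u \<in> I" "L > 0" for u L
    using ray_point_mem[OF C' x touches_closure(1)[OF tI]] that by (simp add: P_def)
  have "eventually (\<lambda>L. norm (f (P u L) - f x) \<le> A * L) at_top" if u: "u \<in> I" for u
  proof -
    have "y u \<in> frontier C" using touches_frontier[OF tI[OF u] C'(1)] .
    then obtain c where c: "\<And>L. L > 0 \<Longrightarrow> hilbert_dist C x (P u L) \<le> L / 2 + c"
      using hilbert_dist_ray_point_le[OF C x] unfolding P_def by metis
    have "norm (f (P u L) - f x) \<le> A * L" if L: "L \<ge> max 1 (2 * c + 2 * B / A)" for L
    proof -
      have "norm (f x - f (P u L)) \<le> A * hilbert_dist C x (P u L) + B"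
        using f[OF x P[OF u]] L by simp
      also have "A * hilbert_dist C x (P u L) \<le> A * (L / 2 + c)"
        using A c L by (intro mult_left_mono) auto
      also have "A * (L / 2 + c) + B = A * (L / 2 + c + B / A)" using A by (simp add: field_simps)
      also have "\<dots> \<le> A * L" using A L by (intro mult_left_mono) auto
      finally show ?thesis by (simp add: norm_minus_commute)
    qed
    then show ?thesis unfolding eventually_at_top_linorder by blast
  qed
  then have ev1: "eventually (\<lambda>L. \<forall>u\<in>I. norm (f (P u L) - f x) \<le> A * L) at_top"
    using I(1) by (simp add: eventually_ball_finite)
  have "eventually (\<lambda>L. u \<noteq> v \<longrightarrow> L / (2 * A) \<le> norm (f (P u L) - f (P v L))) at_top"
    if uv: "u \<in> I" "v \<in> I" for u v
  proof (cases "u = v")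
    case False
    then obtain c where c: "\<And>L. L > 0 \<Longrightarrow> L - c \<le> hilbert_dist C (P u L) (P v L)"
      using hilbert_dist_ray_points_ge[OF C x tI[OF uv(1)] tI[OF uv(2)]] unfolding P_def by metis
    have "L / (2 * A) \<le> norm (f (P u L) - f (P v L))" if L: "L \<ge> max 1 (2 * c + 2 * A * B)" for L
    proof -
      have "L / (2 * A) = 1 / A * (L / 2)" by simp
      also have "\<dots> \<le> 1 / A * (L - c - A * B)" using A L by (intro mult_left_mono) auto
      also have "\<dots> = 1 / A * (L - c) - B" using A by (simp add: field_simps)
      also have "1 / A * (L - c) \<le> 1 / A * hilbert_dist C (P u L) (P v L)"
        using A c L by (intro mult_left_mono) auto
      also have "1 / A * hilbert_dist C (P u L) (P v L) - B \<le> norm (f (P u L) - f (P v L))"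
        using f[OF P P] uv L by simp
      finally show ?thesis by simp
    qed
    then show ?thesis unfolding eventually_at_top_linorder by blast
  qed simp
  then have ev2: "eventually (\<lambda>L. \<forall>u\<in>I. \<forall>v\<in>I. u \<noteq> v \<longrightarrow>
      L / (2 * A) \<le> norm (f (P u L) - f (P v L))) at_top"
    using I(1) by (simp add: eventually_ball_finite)
  obtain L where L: "L > 0" and L1: "\<And>u. u \<in> I \<Longrightarrow> norm (f (P u L) - f x) \<le> A * L"
    and L2: "\<And>u v. \<lbrakk>u \<in> I; v \<in> I; u \<noteq> v\<rbrakk> \<Longrightarrow> L / (2 * A) \<le> norm (f (P u L) - f (P v L))"
    using eventually_happens[OF eventually_conj[OF eventually_gt_at_top[of 0]
        eventually_conj[OF ev1 ev2]]] by auto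
  define g where "g u = (f (P u L) - f x) /\<^sub>R L" for u
  have "norm (g u) \<le> A" if "u \<in> I" for u
    using L L1[OF that] by (simp add: g_def divide_inverse_commute[symmetric] pos_divide_le_eq)
  then have "g ` I \<subseteq> cball 0 A" by auto
  moreover have "1 / (2 * A) \<le> dist (g u) (g v)" if "u \<in> I" "v \<in> I" "u \<noteq> v" for u v
  proof -
    have "g u - g v = (f (P u L) - f (P v L)) /\<^sub>R L"
      unfolding g_def scaleR_diff_right[symmetric] by simp
    then have "dist (g u) (g v) = norm (f (P u L) - f (P v L)) / L"
      using L by (simp add: dist_norm divide_inverse_commute)
    moreover have "1 / (2 * A) = L / (2 * A) / L" using L by simp
    moreover have "L / (2 * A) / L \<le> norm (f (P u L) - f (P v L)) / L"
      using L2[OF that] L by (intro divide_right_mono) auto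
    ultimately show ?thesis by (simp only:)
  qed
  ultimately have "card I \<le> M" using M I(1) by blast
  then show False using I(2) by simp
qed

theorem theorem1p4:
  fixes C :: "(real ^ 'n) set" and A B :: real
  assumes "hilbert_domain C"
    and "\<exists>E :: 'v::real_normed_vector set. finite E \<and> span E = UNIV"
    and "A \<ge> 1" and "B \<ge> 0"
    and "quasi_isometric A B C (hilbert_dist C) TYPE('v)"
  shows "\<exists>P. convex_polytope P \<and> C = interior P"
proof -
  have C: "open C" "convex C" "bounded C" "C \<noteq> {}"
    using assms(1) by (auto simp: hilbert_domain_def)
  have "finite {u. \<exists>y. touches C u y}"
    using quasi_isometric_finite_touches[OF assms(1) _ _ assms(3,5)] assms(2) by blast
  then have "polytope (closure C)" by (rule finite_touches_imp_polytope[OF C])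
  then obtain F where F: "finite F" "closure C = convex hull F" by (auto simp: polytope_def)
  have int: "interior (closure C) = C"
    using convex_interior_closure[OF C(2)] C(1) by (simp add: interior_open)
  then have "affine hull (convex hull F) = UNIV"
    using affine_hull_nonempty_interior[of "closure C"] C(4) F(2) by simp
  then have "convex_polytope (closure C)"
    using F by (auto simp: convex_polytope_def)
  then show ?thesis using int by blast
qed

end
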